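(* The $\mathcal{S}^*_{car}$-radius (the largest $r$ such that $f(rz)/r\in\mathcal{S}^*_{car}$ for every $f$ in the class) for the following subclasses of starlike functions is: (a) for $\mathcal{S}^*(\sqrt{1+cz})$ with $3/4<c\leq 1$: $r_1=\dfrac{3}{4c}$; (b) for $\mathcal{S}^*_L(\alpha)$ with $0\leq \alpha<1/2$: $r_2=\dfrac{3-4\alpha}{4(1-\alpha)^2}$; (c) for $\mathcal{S}^*_e(\alpha)$ with $0\leq \alpha<\dfrac{e-2}{2(e-1)}$: $r_3=\log\left(\dfrac{2(1-\alpha)}{1-2\alpha}\right)$; (d) for $\mathcal{S}^*_{RL}$: $r_4=\dfrac{1}{82}(39+17\sqrt{2})\approx 0.7688$; (e) for $\mathcal{S}^*_C$: $r_5=\dfrac{1}{2}$; (f) for $\mathcal{S}^*_{lim}$: $r_6=\sqrt{2}-1\approx 0.414$; (g) for $\mathcal{S}^*_{\mathrm{crescent}}$: $r_7=\dfrac{3}{4}$; (h) for $\mathcal{S}^*_{sin}$: $r_8=\sin^{-1}(1/2)\approx 0.523598$; (i) for $\mathcal{S}^*_{ne}$: $r_9\approx 0.557875$, where $r_9$ is the smallest positive real root of $2r^3-6r+3=0$ in $(0,1)$. All bounds are sharp.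
   Context: Let $\mathbb{D}$ be the unit disk, $\mathbb{D}_r=\{|z|<r\}$, and $\mathcal{A}$ the class of analytic $f$ on $\mathbb{D}$ with $f(0)=f'(0)-1=0$. For a Ma–Minda function $\varphi$, $\mathcal{S}^*(\varphi)$ denotes the class of $f\in\mathcal{A}$ with $zf'(z)/f(z)\prec\varphi(z)$ in $\mathbb{D}$. Here $\mathcal{S}^*_{car}=\mathcal{S}^*(\phi_{car})$ with $\phi_{car}(z)=1+z+z^2/2$, whose image $\phi_{car}(\mathbb{D})$ is the domain bounded by the cardioid $(4x^2+4y^2-8x-1)^2+4(4x^2+4y^2-12x+1)=0$. The classes are: $\mathcal{S}^*(\sqrt{1+cz})$ ($0<c\leq1$); $\mathcal{S}^*_L(\alpha)=\mathcal{S}^*(\alpha+(1-\alpha)\sqrt{1+z})$; $\mathcal{S}^*_e(\alpha)=\mathcal{S}^*(\alpha+(1-\alpha)e^z)$ ($0\le\alpha<1$); $\mathcal{S}^*_{RL}=\mathcal{S}^*\big(\sqrt{2}-(\sqrt{2}-1)((1-z)/(1+2(\sqrt{2}-1)z))^{1/2}\big)$; $\mathcal{S}^*_C=\mathcal{S}^*(1+4z/3+2z^2/3)$; $\mathcal{S}^*_{lim}=\mathcal{S}^*(1+\sqrt{2}z+z^2/2)$; $\mathcal{S}^*_{\mathrm{crescent}}=\mathcal{S}^*(z+\sqrt{1+z^2})$ (the class of starlike functions associated with a crescent-shaped region); $\mathcal{S}^*_{sin}=\mathcal{S}^*(1+\sin z)$; $\mathcal{S}^*_{ne}=\mathcal{S}^*(1+z-z^3/3)$.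 *)

theory Defs
  imports "HOL-Analysis.Analysis"
begin

definition subordinate :: "(complex \<Rightarrow> complex) \<Rightarrow> (complex \<Rightarrow> complex) \<Rightarrow> bool" where
  "subordinate f g \<longleftrightarrow>
     (\<exists>w. w holomorphic_on ball 0 1 \<and> w 0 = 0 \<and> (\<forall>z\<in>ball 0 1. norm (w z) < 1) \<and>
          (\<forall>z\<in>ball 0 1. f z = g (w z)))"

definition classA :: "(complex \<Rightarrow> complex) set" where
  "classA = {f. f holomorphic_on ball 0 1 \<and> f 0 = 0 \<and> deriv f 0 = 1}"

text \<open>The function z f'(z) / f(z), with its removable value 1 at z = 0.\<close>
definition logderiv_quot :: "(complex \<Rightarrow> complex) \<Rightarrow> complex \<Rightarrow> complex" where
  "logderiv_quot f z = (if z = 0 then 1 else z * deriv f z / f z)"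

text \<open>S*(phi): f in A, z f'/f (analytic, so f has no zeros in the punctured disk)
  subordinate to phi.\<close>
definition starlike_phi :: "(complex \<Rightarrow> complex) \<Rightarrow> (complex \<Rightarrow> complex) set" where
  "starlike_phi phi = {f. f \<in> classA \<and> (\<forall>z\<in>ball 0 1. z \<noteq> 0 \<longrightarrow> f z \<noteq> 0) \<and>
                          subordinate (logderiv_quot f) phi}"

definition phi_car :: "complex \<Rightarrow> complex" where
  "phi_car z = 1 + z + z^2 / 2"

definition S_car :: "(complex \<Rightarrow> complex) set" where
  "S_car = starlike_phi phi_car"

definition scaled :: "(complex \<Rightarrow> complex) \<Rightarrow> real \<Rightarrow> complex \<Rightarrow> complex" where
  "scaled f r = (\<lambda>z. f (of_real r * z) / of_real r)"

definition is_car_radius :: "(complex \<Rightarrow> complex) set \<Rightarrow> real \<Rightarrow> bool" where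
  "is_car_radius K r0 \<longleftrightarrow>
     (0 < r0 \<and> r0 \<le> 1 \<and> (\<forall>f\<in>K. scaled f r0 \<in> S_car)) \<and>
     (\<forall>r. 0 < r \<and> r \<le> 1 \<and> (\<forall>f\<in>K. scaled f r \<in> S_car) \<longrightarrow> r \<le> r0)"

end

theory Submission
  imports Defs "HOL-Complex_Analysis.Complex_Analysis"
begin

text \<open>Since \<open>phi_car z = ((1 + z)\<^sup>2 + 1) / 2\<close>, a value \<open>p\<close> lies in \<open>phi_car ` D\<close> iff
  \<open>|csqrt (2 p - 1) - 1| < 1\<close>, and by the Schwarz lemma every \<open>r\<close> with \<open>\<phi> ` D\<^sub>r \<subseteq> phi_car ` D\<close> is
  admissible for \<open>starlike_phi \<phi>\<close>. In all nine cases \<open>\<phi> (-r)\<close> is the cusp \<open>1/2\<close> of the cardioid,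
  which gives sharpness, and \<open>\<phi> ` D\<^sub>r\<close> stays in the part of the disc \<open>|p - 5/4| < 5/4\<close> to the right
  of the cusp, which is contained in the cardioid.\<close>

text \<open>With W = 2 p - 1 the cardioid is |W| < 2 (1 + cos (arg W)) and the disc is |W - 3/2| <
  5/2. Its circle is the one through the points 4 and +-2i of the cardioid: it reaches the rightmost
  point \<open>phi_car 1\<close> = 5/2 and is as wide as the cardioid on the vertical line through
  the cusp. The cardioid also bends round its cusp into Re W < 0, but the nine images do not enter
  that part. The two conditions behave differently. At u = -r the image touches the cusp, so Re p >
  1/2 has no slack and needs estimates that are exact at -r. The disc condition has room to spare,
  so decimal constants and triangle inequalities are good enough there.\<close>

lemma csqrt_cardioid:
  fixes W :: complex
  assumes pos: "0 < Re W" and disc: "(norm W)\<^sup>2 < 4 + 3 * Re W"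
  shows "norm (csqrt W - 1) < 1"
proof -
  define s where "s = csqrt W"
  define \<rho> where "\<rho> = (norm s)\<^sup>2"
  have W: "W = s\<^sup>2"
    by (simp add: s_def)
  have p: "0 \<le> Re s"
    using csqrt_principal[of W] by (auto simp: s_def)
  have \<rho>: "\<rho> = (Re s)\<^sup>2 + (Im s)\<^sup>2"
    by (simp add: \<rho>_def cmod_power2)
  have ReW: "Re W = 2 * (Re s)\<^sup>2 - \<rho>"
    by (simp add: W \<rho> power2_eq_square)
  have nW: "norm W = \<rho>"
    by (simp add: W \<rho>_def norm_power)
  have d: "\<rho>\<^sup>2 + 3 * \<rho> - 4 < 6 * (Re s)\<^sup>2" and q: "\<rho> < 2 * (Re s)\<^sup>2"
    using disc pos unfolding ReW nW by simp_all
  have \<rho>p: "(Re s)\<^sup>2 \<le> \<rho>" and \<rho>0: "0 \<le> \<rho>"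
    by (simp_all add: \<rho>)
  \<comment> \<open>This is |s - 1| < 1 expanded. If it failed, \<open>pos\<close> would give \<rho>
    > 2 and \<open>disc\<close> would give (\<rho> - 2)(\<rho> - 4) > 0, hence \<rho> > 4, while (Re
    s)^2 \<le> \<rho> forces \<rho> < 4. The roots 2 and 4 are the moduli of the points where circle
    and cardioid meet.\<close>
  have "\<rho> < 2 * Re s"
  proof (rule ccontr)
    assume "\<not> \<rho> < 2 * Re s"
    then have "2 * Re s \<le> \<rho>" by simp
    then have sq: "4 * (Re s)\<^sup>2 \<le> \<rho>\<^sup>2"
      using power_mono[of "2 * Re s" \<rho> 2] p by (simp add: power_mult_distrib)
    have "\<rho> * 2 < \<rho> * \<rho>"
      using q sq by (simp add: power2_eq_square)
    then have "2 < \<rho>"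
      using \<rho>0 by (metis mult_le_cancel_left not_less)
    moreover have "0 < (\<rho> - 2) * (\<rho> - 4)"
      using d sq by (simp add: algebra_simps power2_eq_square)
    ultimately have "4 < \<rho>"
      by (simp add: zero_less_mult_iff)
    moreover have "(\<rho> - 4) * (\<rho> + 1) < 0"
      using d \<rho>p by (simp add: algebra_simps power2_eq_square)
    ultimately show False
      by (simp add: mult_less_0_iff)
  qed
  moreover have "(norm (s - 1))\<^sup>2 = \<rho> - 2 * Re s + 1"
    unfolding cmod_power2 \<rho> by (simp add: power2_eq_square algebra_simps)
  ultimately have "(norm (s - 1))\<^sup>2 < 1\<^sup>2" by simp
  then show ?thesis
    unfolding s_def by (rule power2_less_imp_less) simp
qed

text \<open>The conditions say \<open>|p - 5/4| < 5/4\<close> and \<open>Re p > 1/2\<close>; under \<open>W = 2 p - 1\<close> this set lies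
  inside the cardioid \<open>|W|\<^sup>2 < 2 (|W| + Re W)\<close> and touches its cusp \<open>W = 0\<close>.\<close>
definition disc_segment :: "complex set" where
  "disc_segment = {p. 1/2 < Re p \<and> (norm p)\<^sup>2 < 5/2 * Re p}"

lemma disc_segment_csqrt:
  assumes "p \<in> disc_segment"
  shows "norm (csqrt (2 * p - 1) - 1) < 1" "2 * p - 1 \<notin> \<real>\<^sub>\<le>\<^sub>0"
proof -
  have Re: "0 < Re (2 * p - 1)"
    using assms by (simp add: disc_segment_def)
  show "2 * p - 1 \<notin> \<real>\<^sub>\<le>\<^sub>0"
    using Re by (auto simp: complex_nonpos_Reals_iff)
  have "(norm (2 * p - 1))\<^sup>2 = 4 * (norm p)\<^sup>2 - 4 * Re p + 1"
    unfolding cmod_power2 by (simp add: power2_eq_square algebra_simps)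
  then have "(norm (2 * p - 1))\<^sup>2 < 4 + 3 * Re (2 * p - 1)"
    using assms by (simp add: disc_segment_def)
  with Re show "norm (csqrt (2 * p - 1) - 1) < 1"
    by (rule csqrt_cardioid)
qed

text \<open>The circles |p - 1| = 1 and |p - 5/4| = 5/4 are tangent at 0, so the smaller disc lies
  inside the larger. Its centre is the value of each \<phi> at 0, which makes it accessible to the
  triangle inequality.\<close>

lemma disc_segmentI:
  assumes "1/2 < Re p" "norm (p - 1) \<le> 1"
  shows "p \<in> disc_segment"
proof -
  have "(norm (p - 1))\<^sup>2 \<le> 1"
    using assms(2) by (simp add: power_le_one)
  moreover have "(norm (p - 1))\<^sup>2 = (norm p)\<^sup>2 - 2 * Re p + 1"
    unfolding cmod_power2 by (simp add: power2_eq_square algebra_simps)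
  ultimately show ?thesis
    using assms(1) by (simp add: disc_segment_def)
qed

text \<open>The radius is the distance from 1 to the cusp, so this loses nothing when |\<phi> - 1|
  is largest at -r, as it is for the square-root families.\<close>

lemma disc_segmentI_ball:
  assumes "norm (p - 1) < 1/2"
  shows "p \<in> disc_segment"
proof (rule disc_segmentI)
  show "1/2 < Re p"
    using assms abs_Re_le_cmod[of "p - 1"] by simp
qed (use assms in simp)

section \<open>Radius criterion: extremal function, dilation and subordination\<close>

text \<open>The extremal function \<open>z exp (\<integral>(\<phi> - 1)/z)\<close>.\<close>
lemma exists_starlike_extremal:
  assumes hol: "\<phi> holomorphic_on ball 0 1" and \<phi>0: "\<phi> 0 = 1"
  obtains f where "f \<in> starlike_phi \<phi>" "\<And>z. norm z < 1 \<Longrightarrow> logderiv_quot f z = \<phi> z"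
proof -
  \<comment> \<open>This is (\<phi> - 1)/z with its singularity at 0 removed, so that it has a
    primitive on the convex disc.\<close>
  define h where "h = (\<lambda>z. if z = 0 then deriv \<phi> 0 else (\<phi> z - \<phi> 0) / (z - 0))"
  have "h holomorphic_on ball 0 1"
    unfolding h_def by (rule pole_lemma_open[OF hol]) simp
  then obtain g where g: "\<And>z. z \<in> ball 0 1 \<Longrightarrow> (g has_field_derivative h z) (at z within ball 0 1)"
    using holomorphic_convex_primitive'[of "ball (0::complex) 1" h] by auto
  then have g': "(g has_field_derivative h z) (at z)" if "norm z < 1" for z
    using that by (metis at_within_open dist_0_norm mem_ball open_ball)
  define f where "f = (\<lambda>z. z * exp (g z - g 0))"
  have zh: "1 + z * h z = \<phi> z" for z
    by (simp add: h_def \<phi>0)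
  have f': "(f has_field_derivative exp (g z - g 0) * \<phi> z) (at z)" if "norm z < 1" for z
    unfolding f_def zh[symmetric]
    by (rule derivative_eq_intros g' that refl | simp add: algebra_simps)+
  have d: "deriv f z = exp (g z - g 0) * \<phi> z" if "norm z < 1" for z
    using f'[OF that] by (rule DERIV_imp_deriv)
  have q: "logderiv_quot f z = \<phi> z" if "norm z < 1" for z
    using d[OF that] by (simp add: logderiv_quot_def f_def \<phi>0)
  have "f holomorphic_on ball 0 1"
    by (subst holomorphic_on_open) (use f' in \<open>auto intro!: exI\<close>)
  then have "f \<in> classA"
    using d[of 0] by (simp add: classA_def f_def \<phi>0)
  moreover have "subordinate (logderiv_quot f) \<phi>"
    unfolding subordinate_def by (rule exI[of _ "\<lambda>z. z"]) (auto simp: q)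
  ultimately have "f \<in> starlike_phi \<phi>"
    by (auto simp: starlike_phi_def f_def)
  with q show ?thesis using that by blast
qed

text \<open>The factors r and 1/r cancel in z f'/f, so dilating f only restricts its quotient to a
  smaller disc.\<close>

lemma logderiv_quot_scaled:
  assumes "f holomorphic_on ball 0 1" "0 < r" "r \<le> 1" "norm z < 1"
  shows "logderiv_quot (scaled f r) z = logderiv_quot f (of_real r * z)"
    and "(scaled f r has_field_derivative deriv f (of_real r * z)) (at z)"
proof -
  have "norm (of_real r * z) < 1"
    using assms mult_left_le_one_le[of "norm z" r] by (simp add: norm_mult)
  then have "(f has_field_derivative deriv f (of_real r * z)) (at (of_real r * z))"
    using assms(1) holomorphic_derivI by fastforce
  moreover have "((\<lambda>z. of_real r * z) has_field_derivative of_real r) (at z)"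
    by (rule derivative_eq_intros refl | simp)+
  ultimately have "((\<lambda>z. f (of_real r * z)) has_field_derivative deriv f (of_real r * z) * of_real r) (at z)"
    by (rule DERIV_chain2)
  from DERIV_cdivide[OF this, of "of_real r"]
  show D: "(scaled f r has_field_derivative deriv f (of_real r * z)) (at z)"
    using assms(2) by (simp add: scaled_def)
  show "logderiv_quot (scaled f r) z = logderiv_quot f (of_real r * z)"
    using assms(2) by (simp add: logderiv_quot_def DERIV_imp_deriv[OF D]) (simp add: scaled_def)
qed

lemma scaled_in_S_car:
  assumes hol: "\<phi> holomorphic_on ball 0 1" and \<phi>0: "\<phi> 0 = 1" and r: "0 < r" "r \<le> 1"
    and sub: "\<And>u. norm u < r \<Longrightarrow> \<phi> u \<in> disc_segment"
    and f: "f \<in> starlike_phi \<phi>"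
  shows "scaled f r \<in> S_car"
proof -
  have fA: "f holomorphic_on ball 0 1" "f 0 = 0" "deriv f 0 = 1"
    and nz: "\<And>z. norm z < 1 \<Longrightarrow> z \<noteq> 0 \<Longrightarrow> f z \<noteq> 0"
    and "subordinate (logderiv_quot f) \<phi>"
    using f by (auto simp: starlike_phi_def classA_def)
  then obtain w where w: "w holomorphic_on ball 0 1" "w 0 = 0"
      "\<And>z. norm z < 1 \<Longrightarrow> norm (w z) < 1"
      "\<And>z. norm z < 1 \<Longrightarrow> logderiv_quot f z = \<phi> (w z)"
    by (auto simp: subordinate_def)
  have rz: "norm (of_real r * z) < r" "norm (of_real r * z) < 1" if "norm z < 1" for z :: complex
  proof -
    show "norm (of_real r * z) < r" using r that by (simp add: norm_mult)
    with r show "norm (of_real r * z) < 1" by linarith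
  qed
  have wr: "norm (w (of_real r * z)) < r" if "norm z < 1" for z
    using Schwarz_Lemma(1)[OF w(1,2,3) rz(2)[OF that]] rz(1)[OF that] by simp
  \<comment> \<open>The subordination witness is the explicit inverse of \<open>phi_car\<close>: p =
    \<open>phi_car v\<close> means (1 + v)^2 = 2 p - 1. The segment keeps 2 p - 1 off the branch
    cut, and \<open>csqrt\<close> 1 = 1 makes v vanish at 0.\<close>
  define v where "v = (\<lambda>z. csqrt (2 * \<phi> (w (of_real r * z)) - 1) - 1)"
  have inner: "(\<lambda>z. w (of_real r * z)) holomorphic_on ball 0 1"
    by (rule holomorphic_on_compose_gen[OF _ w(1), unfolded o_def])
       (auto intro!: holomorphic_intros dest: rz)
  have "(\<lambda>z. \<phi> (w (of_real r * z))) holomorphic_on ball 0 1"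
    by (rule holomorphic_on_compose_gen[OF inner hol, unfolded o_def]) (use rz(2) w(3) in auto)
  then have "v holomorphic_on ball 0 1"
    unfolding v_def by (intro holomorphic_intros) (use disc_segment_csqrt(2)[OF sub] wr in auto)
  moreover have "v 0 = 0"
    by (simp add: v_def w(2) \<phi>0)
  moreover have "norm (v z) < 1" if "norm z < 1" for z
    unfolding v_def by (rule disc_segment_csqrt(1)[OF sub[OF wr[OF that]]])
  moreover have "logderiv_quot (scaled f r) z = phi_car (v z)" if "norm z < 1" for z
  proof -
    have "(1 + v z)\<^sup>2 = 2 * \<phi> (w (of_real r * z)) - 1"
      by (simp add: v_def)
    then have "phi_car (v z) = \<phi> (w (of_real r * z))"
      by (simp add: phi_car_def power2_eq_square field_simps)
    then show ?thesis
      using logderiv_quot_scaled(1)[OF fA(1) r that] w(4)[OF rz(2)[OF that]] by simp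
  qed
  ultimately have "subordinate (logderiv_quot (scaled f r)) phi_car"
    unfolding subordinate_def by (intro exI[of _ v]) auto
  moreover have "scaled f r \<in> classA"
  proof -
    have "scaled f r holomorphic_on ball 0 1"
      by (subst holomorphic_on_open)
         (use logderiv_quot_scaled(2)[OF fA(1) r] in \<open>auto intro!: exI\<close>)
    moreover have "deriv (scaled f r) 0 = 1"
      using DERIV_imp_deriv[OF logderiv_quot_scaled(2)[OF fA(1) r, of 0]] fA(3) by simp
    ultimately show ?thesis
      by (simp add: classA_def scaled_def fA(2))
  qed
  moreover have "scaled f r z \<noteq> 0" if "norm z < 1" "z \<noteq> 0" for z
    using nz[OF rz(2)[OF that(1)]] that(2) r by (simp add: scaled_def)
  ultimately show ?thesis
    by (simp add: S_car_def starlike_phi_def)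
qed

text \<open>Sharpness comes from the critical value \<open>phi_car (-1) = 1/2\<close>, which \<open>phi_car\<close> omits on the
  open disc since \<open>phi_car v = 1/2 + (1 + v)\<^sup>2/2\<close>.\<close>
lemma is_car_radiusI:
  assumes hol: "\<phi> holomorphic_on ball 0 1" and \<phi>0: "\<phi> 0 = 1" and r: "0 < r" "r \<le> 1"
    and half: "\<phi> (- of_real r) = 1/2"
    and sub: "\<And>u. norm u < r \<Longrightarrow> \<phi> u \<in> disc_segment"
  shows "is_car_radius (starlike_phi \<phi>) r"
proof -
  have "s \<le> r" if s: "0 < s" "s \<le> 1" and all: "\<forall>f\<in>starlike_phi \<phi>. scaled f s \<in> S_car" for s
  proof (rule ccontr)
    assume "\<not> s \<le> r"
    then have rs: "r < s" by simp
    obtain f where f: "f \<in> starlike_phi \<phi>" "\<And>z. norm z < 1 \<Longrightarrow> logderiv_quot f z = \<phi> z"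
      using exists_starlike_extremal[OF hol \<phi>0] by blast
    \<comment> \<open>Since s > r this point is inside the disc, and dilation by s carries it to -r,
      where the extremal quotient equals 1/2.\<close>
    define z where "z = (- of_real (r / s) :: complex)"
    have z: "norm z < 1" and sz: "of_real s * z = - of_real r"
      using rs r s by (simp_all add: z_def norm_divide)
    have "f holomorphic_on ball 0 1"
      using f(1) by (simp add: starlike_phi_def classA_def)
    then have "logderiv_quot (scaled f s) z = \<phi> (- of_real r)"
      using logderiv_quot_scaled(1)[of f s z] s z f(2)[of "- of_real r"] rs r by (simp add: sz)
    moreover obtain v where "\<forall>z\<in>ball 0 1. norm (v z) < 1"
        "\<forall>z\<in>ball 0 1. logderiv_quot (scaled f s) z = phi_car (v z)"
      using all f(1) unfolding S_car_def starlike_phi_def subordinate_def by blast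
    ultimately have v: "norm (v z) < 1" "phi_car (v z) = 1/2"
      using z half by auto
    have "(1 + v z)\<^sup>2 = 2 * phi_car (v z) - 1"
      by (simp add: phi_car_def power2_eq_square algebra_simps)
    then have "1 + v z = 0"
      using v(2) by simp
    then have "norm (v z) = 1"
      by (metis add_eq_0_iff norm_minus_cancel norm_one)
    with v(1) show False by simp
  qed
  then show ?thesis
    using r scaled_in_S_car[OF hol \<phi>0 r sub] by (simp add: is_car_radius_def)
qed

section \<open>Real inequalities for exp, cosh and cos\<close>

text \<open>The quadratic Taylor polynomials at x and -x multiply to 1 + x^4/4 \<ge> 1, so the lower
  bound for exp x turns into an upper bound for its reciprocal.\<close>

lemma exp_minus_upper_Taylor_quadratic:
  fixes x :: real
  assumes "0 \<le> x"
  shows "exp (- x) \<le> 1 - x + x\<^sup>2 / 2"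
proof -
  have pos: "0 < 1 - x + x\<^sup>2 / 2"
    using sum_power2_gt_zero_iff[of "x - 1" 1] by (simp add: power2_eq_square algebra_simps)
  have "(1 + x + x\<^sup>2 / 2) * (1 - x + x\<^sup>2 / 2) = 1 + (x\<^sup>2)\<^sup>2 / 4"
    by (simp add: power2_eq_square algebra_simps)
  then have "1 \<le> (1 + x + x\<^sup>2 / 2) * (1 - x + x\<^sup>2 / 2)"
    by simp
  also have "\<dots> \<le> exp x * (1 - x + x\<^sup>2 / 2)"
    using exp_lower_Taylor_quadratic[OF assms] pos by (intro mult_right_mono) auto
  finally show ?thesis
    by (simp add: exp_minus field_simps)
qed

lemma sinh_ge_self:
  fixes x :: real
  assumes "0 \<le> x"
  shows "x \<le> sinh x"
  using exp_minus_upper_Taylor_quadratic[OF assms] exp_lower_Taylor_quadratic[OF assms]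
  by (simp add: sinh_field_def)

lemma cosh_upper_quadratic:
  fixes y :: real
  assumes "\<bar>y\<bar> \<le> 1"
  shows "cosh y \<le> 1 + y\<^sup>2"
proof -
  define a where "a = \<bar>y\<bar>"
  have a: "0 \<le> a" "a \<le> 1"
    using assms by (simp_all add: a_def)
  have "cosh a \<le> 1 + a\<^sup>2"
    using exp_bound[OF a] exp_minus_upper_Taylor_quadratic[OF a(1)] zero_le_power2[of a]
    unfolding cosh_field_def by argo
  then show ?thesis by (simp add: a_def)
qed

lemma cosh_minus_quadratic_mono:
  fixes s t :: real
  assumes "0 \<le> s" "s \<le> t"
  shows "cosh s - s\<^sup>2 / 2 \<le> cosh t - t\<^sup>2 / 2"
proof (rule DERIV_nonneg_imp_nondecreasing[OF assms(2)])
  fix x assume "s \<le> x" "x \<le> t"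
  then show "\<exists>y. ((\<lambda>x. cosh x - x\<^sup>2 / 2) has_real_derivative y) (at x) \<and> 0 \<le> y"
    using sinh_ge_self[of x] assms(1)
    by (intro exI[of _ "sinh x - x"]) (auto intro!: derivative_eq_intros)
qed

lemma cos_lower_quadratic: "1 - y\<^sup>2 / 2 \<le> cos y" for y :: real
proof -
  have "cos y = 1 - 2 * (sin (y / 2))\<^sup>2"
    using cos_double_sin[of "y / 2"] by simp
  moreover have "(sin (y / 2))\<^sup>2 \<le> (y / 2)\<^sup>2"
    using abs_sin_x_le_abs_x[of "y / 2"] unfolding abs_le_square_iff .
  ultimately show ?thesis
    by (simp add: power_divide)
qed

text \<open>For x = m/n, comparing n-th powers reduces a bound on exp x to rational arithmetic with
  e < 2.72; the companion lower bound uses 2.71.\<close>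

lemma exp_rational_less:
  assumes "(272/100) ^ m < b ^ n" "0 \<le> b" "n > 0" "real m = real n * x"
  shows "exp x < b"
proof (rule power_less_imp_less_base)
  have "exp x ^ n = exp (1::real) ^ m"
    using assms(4) by (simp flip: exp_of_nat_mult)
  also have "\<dots> \<le> (272/100) ^ m"
    using e_less_272 by (intro power_mono) auto
  finally show "exp x ^ n < b ^ n" using assms(1) by simp
qed (rule assms(2))

lemma exp_rational_ge:
  assumes "b ^ n \<le> (271/100) ^ m" "n > 0" "real m = real n * x"
  shows "b \<le> exp x"
proof -
  have "b ^ n \<le> exp (1::real) ^ m"
    using e_approx_32 by (intro order.trans[OF assms(1)] power_mono) (auto simp: abs_if split: if_splits)
  also have "\<dots> = exp x ^ n"
    using assms(3) by (simp flip: exp_of_nat_mult)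
  finally show ?thesis
    using power_le_imp_le_base[of b "n - 1" "exp x"] assms(2) by simp
qed

section \<open>The image of a disc under the exponential\<close>

text \<open>With u = x + iy, |exp u - 1|^2 = 2 exp x (cosh x - cos y). Bounding cos y below by 1 -
  y^2/2 and y^2 by r^2 - x^2 leaves cosh x - x^2/2, which is largest at |x| = r. Equality holds at u
  = r and u = -r.\<close>

lemma norm_exp_minus_one_le:
  assumes "norm u \<le> r"
  shows "(norm (exp u - 1))\<^sup>2 \<le> exp (Re u + r) * (1 - exp (- r))\<^sup>2"
proof -
  define x y where "x = Re u" and "y = Im u"
  have xy: "x\<^sup>2 + y\<^sup>2 \<le> r\<^sup>2"
    using assms by (simp add: x_def y_def cmod_power2[symmetric] power_mono)
  have xr: "\<bar>x\<bar> \<le> r"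
    using abs_Re_le_cmod[of u] assms by (simp add: x_def)
  have "(norm (exp u - 1))\<^sup>2 = (exp x)\<^sup>2 * ((sin y)\<^sup>2 + (cos y)\<^sup>2) - 2 * exp x * cos y + 1"
    unfolding cmod_power2
    by (simp add: Re_exp Im_exp x_def y_def power2_eq_square algebra_simps
        del: sin_cos_squared_add sin_cos_squared_add2 sin_cos_squared_add3)
  also have "\<dots> = 2 * exp x * (cosh x - cos y)"
    by (simp add: cosh_field_def exp_minus power2_eq_square field_simps)
  also have "\<dots> \<le> 2 * exp x * (cosh r - 1)"
    using cosh_minus_quadratic_mono[of "\<bar>x\<bar>" r] xr cos_lower_quadratic[of y] xy
    by (intro mult_left_mono) auto
  also have "\<dots> = exp (x + r) * (1 - exp (- r))\<^sup>2"
    by (simp add: cosh_field_def exp_minus exp_add power2_eq_square field_simps)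
  finally show ?thesis by (simp add: x_def)
qed

text \<open>With d = Re u + r the claim is exp (-d) < cos (Im u). The disc and r \<le> 1 give (Im
  u)^2 < d (2 - d), and then 1 - (Im u)^2/2 exceeds exactly the quadratic Taylor polynomial of exp
  (-d).\<close>

lemma Re_exp_gt:
  assumes "norm u < r" "r \<le> 1"
  shows "exp (- r) < Re (exp u)"
proof -
  define x y where "x = Re u" and "y = Im u"
  define d where "d = x + r"
  have xy: "x\<^sup>2 + y\<^sup>2 < r\<^sup>2"
    using assms by (simp add: x_def y_def cmod_power2[symmetric] power_strict_mono)
  have d: "0 < d"
    using abs_Re_le_cmod[of u] assms by (simp add: x_def d_def)
  have "y\<^sup>2 < d * (2 * r - d)"
    using xy by (simp add: d_def power2_eq_square algebra_simps)
  also have "\<dots> \<le> d * (2 - d)"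
    using d assms by (intro mult_left_mono) auto
  finally have "1 - d + d\<^sup>2 / 2 < cos y"
    using cos_lower_quadratic[of y] by (simp add: power2_eq_square algebra_simps)
  then have "exp (- d) < cos y"
    using exp_minus_upper_Taylor_quadratic[of d] d by simp
  then have "exp x * exp (- d) < exp x * cos y" by simp
  then show ?thesis
    by (simp add: Re_exp x_def y_def d_def flip: exp_add)
qed

text \<open>This is the disc condition for 1 + q/(2 M), q = exp u - 1, with denominators
  cleared.\<close>

lemma norm_exp_minus_one_less:
  assumes u: "norm u < r" and r: "r \<le> 1"
  defines "M \<equiv> 1 - exp (- r)"
  shows "(norm (exp u - 1))\<^sup>2 < 6 * M\<^sup>2 + Re (exp u - 1) * M"
proof -
  define x y where "x = Re u" and "y = Im u"
  have r0: "0 < r" using u norm_ge_zero[of u] by linarith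
  have xr: "\<bar>x\<bar> < r"
    using abs_Re_le_cmod[of u] u by (simp add: x_def)
  have M0: "0 < M" using r0 by (simp add: M_def)
  have "1 / exp 1 \<le> exp (- r)"
    using r by (simp add: exp_minus field_simps)
  moreover have "1 / (272/100) < 1 / exp (1::real)"
    using e_less_272 by (intro divide_strict_left_mono) auto
  ultimately have M: "M \<le> 633/1000"
    by (simp add: M_def)
  have xy: "x\<^sup>2 + y\<^sup>2 < 1"
    using power_strict_mono[OF u, of 2] power_le_one[of r 2] r r0
    by (simp add: x_def y_def cmod_power2[symmetric])
  have cosy: "(1 + x\<^sup>2) / 2 \<le> cos y"
    using cos_lower_quadratic[of y] xy by simp
  define E where "E = exp (x + r)"
  have Re: "Re (exp u - 1) = exp x * cos y - 1"
    by (simp add: Re_exp x_def y_def)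
  \<comment> \<open>\<open>Re (exp u - 1) > - M\<close> always holds, so \<open>E < 5\<close> suffices for small \<open>x\<close>; for larger \<open>x\<close> the
    growth of \<open>E\<close> up to \<open>exp 2\<close> is paid for by \<open>Re (exp u - 1)\<close>.\<close>
  have "E * M < 6 * M + Re (exp u - 1)"
  proof -
    \<comment> \<open>The first cut lies just below ln 5 - 1, so that exp (x + r) < 5 on its
      left.\<close>
    consider "x \<le> 6/10" | "6/10 < x" "x \<le> 85/100" | "85/100 < x" by linarith
    then show ?thesis
    proof cases
      case 1
      have "E \<le> exp (8/5)" using 1 r by (simp add: E_def)
      also have "\<dots> < 5"
        by (rule exp_rational_less[of 8 _ 5]) (simp_all add: power_divide)
      finally have "E * M < 5 * M" using M0 by simp
      moreover have "- M < Re (exp u - 1)"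
        using Re_exp_gt[OF u r] by (simp add: M_def)
      ultimately show ?thesis by linarith
    next
      \<comment> \<open>The tight case: 0.37 M \<le> 0.2343 has to stay below exp x cos y - 1 \<ge>
        0.2348, hence the three-digit constants.\<close>
      case 2
      have "E \<le> exp (37/20)" using 2 r by (simp add: E_def)
      also have "\<dots> < 637/100" by (rule exp_rational_less[of 37 _ 20]) (simp_all add: power_divide)
      finally have "E * M \<le> 637/100 * M" using M0 by simp
      moreover have "(1816/1000) * (68/100) \<le> exp x * cos y"
      proof (intro mult_mono)
        have "1816/1000 \<le> exp (6/10 :: real)" by (rule exp_rational_ge[of _ 5 3]) (simp_all add: power_divide)
        then show "1816/1000 \<le> exp x" using 2 by (auto intro: order.trans)
        have "(6/10)\<^sup>2 \<le> x\<^sup>2" using 2 by (intro power_mono) auto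
        then show "68/100 \<le> cos y" using cosy by (simp add: power2_eq_square)
      qed auto
      ultimately show ?thesis using M unfolding Re by linarith
    next
      case 3
      have "E \<le> exp 2" using 3 r xr by (simp add: E_def)
      also have "\<dots> = (exp 1)\<^sup>2" by (simp add: power2_eq_square flip: exp_add)
      also have "\<dots> \<le> (272/100)\<^sup>2" using e_less_272 by (intro power_mono) auto
      finally have "E * M \<le> (272/100)\<^sup>2 * M" using M0 by simp
      moreover have "(225/100) * (86/100) \<le> exp x * cos y"
      proof (intro mult_mono)
        have "225/100 \<le> exp (85/100 :: real)" by (rule exp_rational_ge[of _ 20 17]) (simp_all add: power_divide)
        then show "225/100 \<le> exp x" using 3 by (auto intro: order.trans)
        have "(85/100)\<^sup>2 \<le> x\<^sup>2" using 3 by (intro power_mono) auto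
        then show "86/100 \<le> cos y" using cosy by (simp add: power2_eq_square)
      qed auto
      ultimately show ?thesis using M unfolding Re by (simp add: power2_eq_square)
    qed
  qed
  then have "E * M * M < (6 * M + Re (exp u - 1)) * M"
    using M0 by (intro mult_strict_right_mono)
  moreover have "(norm (exp u - 1))\<^sup>2 \<le> E * M\<^sup>2"
    using norm_exp_minus_one_le[of u r] u by (simp add: E_def M_def x_def)
  ultimately show ?thesis
    by (simp add: power2_eq_square algebra_simps)
qed

text \<open>If \<alpha> + (1 - \<alpha>) exp (-r) = 1/2, then 1 - \<alpha> = 1/(2 (1 - exp (-r))).
  Using r as the parameter removes \<alpha> and the logarithm from the estimates.\<close>

lemma exp_disc_segment:
  assumes u: "norm u < r" and r: "r \<le> 1"
  shows "1 + (exp u - 1) / of_real (2 * (1 - exp (- r))) \<in> disc_segment"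
proof -
  define M where "M = 1 - exp (- r)"
  define q where "q = exp u - 1"
  have M0: "0 < M" using order.strict_trans1[OF norm_ge_zero u] by (simp add: M_def)
  have q: "(norm q)\<^sup>2 < 6 * M\<^sup>2 + Re q * M" "- M < Re q"
    using norm_exp_minus_one_less[OF u r] Re_exp_gt[OF u r] by (simp_all add: M_def q_def)
  have Re: "Re (1 + q / of_real (2 * M)) = 1 + Re q / (2 * M)"
    by simp
  have "(norm (1 + q / of_real (2 * M)))\<^sup>2 = 1 + Re q / M + (norm q)\<^sup>2 / (4 * M\<^sup>2)"
    using M0 unfolding cmod_power2 by (simp add: power2_eq_square field_simps)
  also have "\<dots> < 1 + Re q / M + (6 * M\<^sup>2 + Re q * M) / (4 * M\<^sup>2)"
    using q(1) M0 by (intro add_strict_left_mono divide_strict_right_mono) auto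
  also have "\<dots> = 5/2 * (1 + Re q / (2 * M))"
    using M0 by (simp add: power2_eq_square field_simps)
  finally show ?thesis
    using q(2) M0 unfolding disc_segment_def M_def[symmetric] q_def[symmetric] mem_Collect_eq Re
    by (simp add: field_simps)
qed

section \<open>Square-root families, with the radii for the exponential and RL classes\<close>

text \<open>For S = \<open>csqrt (1 + t)\<close>, (S - 1)(S + 1) = t and |S + 1| \<ge> 1 + Re S
  \<ge> 1 + \<sigma>, where |t| = (1 - \<sigma>)(1 + \<sigma>). The bound is the value approached at
  t = -\<rho>.\<close>

lemma norm_csqrt_one_plus_minus_one_less:
  assumes "norm t < \<rho>" "\<rho> \<le> 1"
  shows "norm (csqrt (1 + t) - 1) < 1 - sqrt (1 - \<rho>)"
proof -
  define S where "S = csqrt (1 + t)"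
  define \<sigma> where "\<sigma> = sqrt (1 - norm t)"
  have t: "norm t < 1" and \<sigma>2: "\<sigma>\<^sup>2 = 1 - norm t" and \<sigma>0: "0 \<le> \<sigma>"
    using assms by (simp_all add: \<sigma>_def)
  have "1 - norm t \<le> norm (1 + t)"
    using norm_diff_ineq[of 1 t] by simp
  moreover have "1 - norm t \<le> Re (1 + t)"
    using abs_Re_le_cmod[of t] by simp
  ultimately have "\<sigma> \<le> Re S"
    unfolding \<sigma>_def S_def csqrt.simps by (intro real_sqrt_le_mono) simp
  then have "1 + \<sigma> \<le> norm (S + 1)"
    using complex_Re_le_cmod[of "S + 1"] by simp
  then have "norm (S - 1) * (1 + \<sigma>) \<le> norm (S - 1) * norm (S + 1)"
    by (intro mult_left_mono) auto
  also have "\<dots> = norm (S\<^sup>2 - 1)"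
    by (simp add: power2_eq_square algebra_simps flip: norm_mult)
  also have "\<dots> = (1 - \<sigma>) * (1 + \<sigma>)"
    using \<sigma>2 unfolding S_def power2_csqrt by (simp add: power2_eq_square algebra_simps)
  finally have "norm (S - 1) \<le> 1 - \<sigma>"
    using \<sigma>0 by simp
  moreover have "sqrt (1 - \<rho>) < \<sigma>"
    using assms by (simp add: \<sigma>_def)
  ultimately show ?thesis by (simp add: S_def)
qed

lemma one_plus_notin_nonpos_Reals: "norm t < 1 \<Longrightarrow> 1 + t \<notin> \<real>\<^sub>\<le>\<^sub>0" for t :: complex
  using abs_Re_le_cmod[of t] by (auto simp: complex_nonpos_Reals_iff)

lemma car_radius_sqrt:
  assumes "3/4 < c" "c \<le> 1"
  shows "is_car_radius (starlike_phi (\<lambda>z. csqrt (1 + of_real c * z))) (3 / (4 * c))"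
proof (rule is_car_radiusI)
  have c: "norm (of_real c * z :: complex) < 1" if "norm z < 1" for z
    using assms that mult_left_le_one_le[of "norm z" c] by (simp add: norm_mult)
  show "(\<lambda>z. csqrt (1 + of_real c * z)) holomorphic_on ball 0 1"
    by (intro holomorphic_intros) (use c one_plus_notin_nonpos_Reals in auto)
  have "csqrt (1/4) = 1/2"
    by (rule csqrt_unique) (auto simp: power2_eq_square)
  then show "csqrt (1 + of_real c * - of_real (3 / (4 * c))) = 1/2"
    using assms by simp
  show "csqrt (1 + of_real c * u) \<in> disc_segment" if "norm u < 3 / (4 * c)" for u
  proof -
    \<comment> \<open>At \<rho> = 3/4 the bound 1 - sqrt (1 - \<rho>) is exactly 1/2.\<close>
    have "norm (of_real c * u) < 3/4"
      using that assms by (simp add: norm_mult field_simps)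
    from norm_csqrt_one_plus_minus_one_less[OF this] show ?thesis
      by (intro disc_segmentI_ball) (simp add: real_sqrt_divide)
  qed
qed (use assms in \<open>auto simp: field_simps\<close>)

lemma car_radius_lemniscate_order:
  assumes "0 \<le> \<alpha>" "\<alpha> < 1/2"
  shows "is_car_radius (starlike_phi (\<lambda>z. of_real \<alpha> + of_real (1 - \<alpha>) * csqrt (1 + z)))
           ((3 - 4 * \<alpha>) / (4 * (1 - \<alpha>)\<^sup>2))" (is "is_car_radius _ ?r")
proof (rule is_car_radiusI)
  have "1 - ?r = (4 * (1 - \<alpha>)\<^sup>2 - (3 - 4 * \<alpha>)) / (4 * (1 - \<alpha>)\<^sup>2)"
    using assms by (simp add: diff_divide_distrib)
  also have "4 * (1 - \<alpha>)\<^sup>2 - (3 - 4 * \<alpha>) = 4 * (1/2 - \<alpha>)\<^sup>2"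
    by (simp add: power2_eq_square algebra_simps)
  finally have "1 - ?r = ((1/2 - \<alpha>) / (1 - \<alpha>))\<^sup>2"
    by (simp add: power_divide)
  then have s: "sqrt (1 - ?r) = (1/2 - \<alpha>) / (1 - \<alpha>)"
    using assms by (simp add: real_sqrt_abs)
  show "0 < ?r"
    using assms by simp
  show r1: "?r \<le> 1"
    using assms sum_power2_ge_zero[of "1 - 2 * \<alpha>" 0] by (simp add: field_simps power2_eq_square)
  show "(\<lambda>z. of_real \<alpha> + of_real (1 - \<alpha>) * csqrt (1 + z)) holomorphic_on ball 0 1"
    by (intro holomorphic_intros) (use one_plus_notin_nonpos_Reals in auto)
  have "csqrt (1 + - of_real ?r) = csqrt (of_real (1 - ?r))"
    by simp
  also have "\<dots> = of_real (sqrt (1 - ?r))"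
    using r1 by (intro csqrt_of_real) simp
  finally have c: "csqrt (1 + - of_real ?r) = of_real ((1/2 - \<alpha>) / (1 - \<alpha>))"
    unfolding s .
  have "\<alpha> + (1 - \<alpha>) * ((1/2 - \<alpha>) / (1 - \<alpha>)) = 1/2"
    using assms by simp
  then have "complex_of_real (\<alpha> + (1 - \<alpha>) * ((1/2 - \<alpha>) / (1 - \<alpha>))) = of_real (1/2)"
    by (simp only:)
  then show "of_real \<alpha> + of_real (1 - \<alpha>) * csqrt (1 + - of_real ?r) = 1/2"
    unfolding c of_real_add of_real_mult by simp
  show "of_real \<alpha> + of_real (1 - \<alpha>) * csqrt (1 + u) \<in> disc_segment" if u: "norm u < ?r" for u
  proof (rule disc_segmentI_ball)
    have "of_real \<alpha> + of_real (1 - \<alpha>) * csqrt (1 + u) - 1 = of_real (1 - \<alpha>) * (csqrt (1 + u) - 1)"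
      by (simp add: algebra_simps)
    then have "norm (of_real \<alpha> + of_real (1 - \<alpha>) * csqrt (1 + u) - 1)
        = (1 - \<alpha>) * norm (csqrt (1 + u) - 1)"
      using assms by (simp only: norm_mult norm_of_real)
    also have "\<dots> < (1 - \<alpha>) * (1 - (1/2 - \<alpha>) / (1 - \<alpha>))"
      using norm_csqrt_one_plus_minus_one_less[OF u r1] assms unfolding s
      by (intro mult_strict_left_mono) auto
    also have "\<dots> = 1/2"
      using assms by (simp add: field_simps)
    finally show "norm (of_real \<alpha> + of_real (1 - \<alpha>) * csqrt (1 + u) - 1) < 1/2" .
  qed
qed simp

lemma car_radius_exp_order:
  assumes "0 \<le> \<alpha>" "\<alpha> < (exp 1 - 2) / (2 * (exp 1 - 1))"
  shows "is_car_radius (starlike_phi (\<lambda>z. of_real \<alpha> + of_real (1 - \<alpha>) * exp z))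
           (ln (2 * (1 - \<alpha>) / (1 - 2 * \<alpha>)))" (is "is_car_radius _ ?r")
proof (rule is_car_radiusI)
  have e: "1 < exp (1::real)" by simp
  \<comment> \<open>The hypothesis on \<alpha> says that the argument of the logarithm is below e,
    so the radius stays below 1.\<close>
  have le: "2 * (1 - \<alpha>) < exp 1 * (1 - 2 * \<alpha>)"
    using assms(2) e by (simp add: field_simps)
  have "\<alpha> < 1/2"
    by (rule less_trans[OF assms(2)]) (use e in \<open>simp add: field_simps\<close>)
  then have \<alpha>: "0 < 1 - 2 * \<alpha>" "0 < 1 - \<alpha>" by auto
  show "0 < ?r"
    using \<alpha> by (intro ln_gt_zero) (simp add: field_simps)
  have "?r \<le> ln (exp 1)"
    using le \<alpha> by (intro ln_mono) (simp_all add: field_simps)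
  then show r1: "?r \<le> 1" by simp
  have er: "exp (- ?r) = (1 - 2 * \<alpha>) / (2 * (1 - \<alpha>))"
    using \<alpha> by (simp add: exp_minus)
  have eq: "of_real \<alpha> + of_real (1 - \<alpha>) * exp u
      = 1 + (exp u - 1) / of_real (2 * (1 - exp (- ?r)))" for u :: complex
  proof -
    have "2 * (1 - exp (- ?r)) = 1 / (1 - \<alpha>)"
      unfolding er using \<alpha> by (simp add: field_simps)
    then show ?thesis
      by (simp only:) (simp add: algebra_simps)
  qed
  have "complex_of_real \<alpha> + of_real (1 - \<alpha>) * exp (- of_real ?r) = of_real (\<alpha> + (1 - \<alpha>) * exp (- ?r))"
    by (simp only: of_real_add of_real_mult exp_of_real[symmetric] of_real_minus)
  also have "\<alpha> + (1 - \<alpha>) * exp (- ?r) = 1/2"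
    unfolding er using \<alpha> by (simp add: field_simps)
  finally show "of_real \<alpha> + of_real (1 - \<alpha>) * exp (- of_real ?r) = (1/2 :: complex)"
    by simp
  show "of_real \<alpha> + of_real (1 - \<alpha>) * exp u \<in> disc_segment" if "norm u < ?r" for u
    unfolding eq by (rule exp_disc_segment[OF that r1])
qed (auto intro!: holomorphic_intros)

lemma car_radius_RL:
  "is_car_radius
      (starlike_phi (\<lambda>z. of_real (sqrt 2) - of_real (sqrt 2 - 1) *
         csqrt ((1 - z) / (1 + 2 * of_real (sqrt 2 - 1) * z))))
      ((39 + 17 * sqrt 2) / 82)"
proof (rule is_car_radiusI)
  define s where "s = sqrt (2::real)"
  define k where "k = 2 * (s - 1)"
  define r where "r = (39 + 17 * s) / 82"
  \<comment> \<open>Forced values: \<tau> solves s - (s - 1) \<tau> = 1/2, and r solves (1 + r)/(1 -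
    k r) = \<tau>^2, so \<open>csqrt (Q (- of_real r))\<close> is \<tau>.\<close>
  define \<tau> where "\<tau> = (3 + s) / 2"
  have ss: "s * s = 2" by (simp add: s_def)
  have s: "1414/1000 < s" "s < 1415/1000"
    unfolding s_def by (rule real_less_rsqrt, simp add: power2_eq_square)
      (rule real_less_lsqrt, simp_all add: power2_eq_square)
  have k: "0 < k" "k < 1" and r: "0 < r" "r < 1" and \<tau>: "0 < \<tau>"
    using s by (simp_all add: k_def r_def \<tau>_def)
  have kr: "0 < 1 - k * r"
    using mult_strict_mono[of k 1 r 1] k r by simp
  have eqr: "1 + r = \<tau>\<^sup>2 * (1 - k * r)"
  proof -
    have \<tau>2: "\<tau>\<^sup>2 = (11 + 6 * s) / 4" and kr: "k * r = (22 * s - 5) / 41"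
      using ss by (simp_all add: \<tau>_def k_def r_def power2_eq_square field_simps)
    then show ?thesis
      using ss unfolding \<tau>2 kr by (simp add: r_def field_simps)
  qed
  have k\<tau>: "(s - 1) * \<tau> = s - 1/2"
    using ss by (simp add: \<tau>_def field_simps)
  define Q where "Q = (\<lambda>z::complex. (1 - z) / (1 + of_real k * z))"
  show "0 < (39 + 17 * sqrt 2) / 82" "(39 + 17 * sqrt 2) / 82 \<le> 1"
    using r by (simp_all add: r_def s_def)
  have Q: "2 * of_real (sqrt 2 - 1) = (of_real k :: complex)"
    by (simp add: k_def s_def)
  have ReQ: "Q z \<notin> \<real>\<^sub>\<le>\<^sub>0" "1 + of_real k * z \<noteq> 0" if z: "norm z < 1" for z
  proof -
    have kz: "norm (of_real k * z) < 1"
      using k z mult_left_le_one_le[of "norm z" k] by (simp add: norm_mult)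
    then show "1 + of_real k * z \<noteq> 0"
      using one_plus_notin_nonpos_Reals[OF kz] by auto
    have "Re ((1 - z) * cnj (1 + of_real k * z)) = (1 - k) * (1 - Re z) + k * (1 - (norm z)\<^sup>2)"
      unfolding cmod_power2 by (simp add: power2_eq_square algebra_simps)
    also have "\<dots> > 0"
      using k abs_Re_le_cmod[of z] z power_strict_mono[OF z, of 2]
      by (intro add_pos_pos mult_pos_pos) auto
    finally have "0 < Re (Q z)"
      unfolding Q_def by (subst Re_complex_div_gt_0)
    then show "Q z \<notin> \<real>\<^sub>\<le>\<^sub>0"
      by (auto simp: complex_nonpos_Reals_iff)
  qed
  show "(\<lambda>z. of_real (sqrt 2) - of_real (sqrt 2 - 1) *
         csqrt ((1 - z) / (1 + 2 * of_real (sqrt 2 - 1) * z))) holomorphic_on ball 0 1"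
    unfolding Q using ReQ unfolding Q_def by (intro holomorphic_intros) auto
  show "of_real (sqrt 2) - of_real (sqrt 2 - 1) *
         csqrt ((1 - 0) / (1 + 2 * of_real (sqrt 2 - 1) * 0)) = (1 :: complex)"
    by simp
  have "Q (- of_real r) = of_real ((1 + r) / (1 - k * r))"
    by (simp add: Q_def)
  also have "(1 + r) / (1 - k * r) = \<tau>\<^sup>2"
    using kr eqr by simp
  finally have "csqrt (Q (- of_real r)) = of_real \<tau>"
    using \<tau> by (simp add: csqrt_of_real)
  then have "of_real s - of_real (s - 1) * csqrt (Q (- of_real r)) = complex_of_real (s - (s - 1) * \<tau>)"
    by simp
  also have "\<dots> = 1/2"
    unfolding k\<tau> by simp
  finally show "of_real (sqrt 2) - of_real (sqrt 2 - 1) *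
         csqrt ((1 - - of_real ((39 + 17 * sqrt 2) / 82)) /
           (1 + 2 * of_real (sqrt 2 - 1) * - of_real ((39 + 17 * sqrt 2) / 82))) = (1/2 :: complex)"
    unfolding Q unfolding Q_def s_def[symmetric] r_def[symmetric] .
  fix u :: complex
  assume "norm u < (39 + 17 * sqrt 2) / 82"
  then have u: "norm u < r" by (simp add: r_def s_def)
  define S where "S = csqrt (Q u)"
  have nS: "norm S < \<tau>"
  proof -
    have ku: "k * norm u < k * r" using u k by simp
    have "1 - k * norm u \<le> norm (1 + of_real k * u)"
      using norm_diff_ineq[of 1 "of_real k * u"] k by (simp add: norm_mult)
    then have "\<tau>\<^sup>2 * (1 - k * r) < \<tau>\<^sup>2 * norm (1 + of_real k * u)"
      using ku \<tau> by simp
    moreover have "norm (1 - u) < 1 + r"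
      using norm_triangle_ineq4[of 1 u] u by simp
    ultimately have "norm (1 - u) < \<tau>\<^sup>2 * norm (1 + of_real k * u)"
      using eqr by simp
    then have "norm (Q u) < \<tau>\<^sup>2"
      using ReQ(2)[of u] u r by (simp add: Q_def norm_divide field_simps)
    then have "norm S ^ 2 < \<tau>\<^sup>2"
      by (simp add: S_def)
    then show ?thesis
      using \<tau> by (intro power2_less_imp_less[of "norm S" \<tau>]) auto
  qed
  have ReS: "0 \<le> Re S" "Re S < \<tau>"
    using Re_csqrt[of "Q u"] complex_Re_le_cmod[of S] nS by (simp_all add: S_def del: csqrt.simps)
  have kS: "(s - 1) * Re S < s - 1/2" "(s - 1) * norm S < s - 1/2"
    unfolding k\<tau>[symmetric] using ReS nS s by (simp_all)
  \<comment> \<open>Only |S| and Re S survive the expansion. Once |S| is bounded by \<tau>, both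
    sides are affine in (s - 1) Re S \<ge> 0 with slopes -2 s and -5/2; since 2 s > 5/2, the case Re
    S = 0 decides.\<close>
  have "(norm (of_real s - of_real (s - 1) * S))\<^sup>2
      = s * s - 2 * s * ((s - 1) * Re S) + ((s - 1) * norm S)\<^sup>2"
    unfolding power_mult_distrib cmod_power2 by (simp add: power2_eq_square algebra_simps)
  also have "((s - 1) * norm S)\<^sup>2 < (s - 1/2)\<^sup>2"
    using kS(2) s by (intro power_strict_mono) auto
  also have "s * s - 2 * s * ((s - 1) * Re S) + (s - 1/2)\<^sup>2 = 4 + 1/4 - s - 2 * s * ((s - 1) * Re S)"
    using ss by (simp add: power2_eq_square algebra_simps)
  also have "\<dots> \<le> 5/2 * s - 5/2 * ((s - 1) * Re S)"
  proof -
    define P where "P = (s - 1) * Re S"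
    have "0 \<le> (2 * s - 5/2) * P"
      using s ReS by (simp add: P_def)
    then have "0 \<le> 2 * s * P - 5/2 * P"
      by (simp only: left_diff_distrib)
    then show ?thesis
      using s unfolding P_def[symmetric] by argo
  qed
  finally have "of_real s - of_real (s - 1) * S \<in> disc_segment"
    using kS(1) by (simp add: disc_segment_def field_simps)
  then show "of_real (sqrt 2) - of_real (sqrt 2 - 1) *
         csqrt ((1 - u) / (1 + 2 * of_real (sqrt 2 - 1) * u)) \<in> disc_segment"
    unfolding Q S_def Q_def s_def .
qed

section \<open>Quadratic polynomials and the crescent\<close>

lemma norm_less_imp_Re_Im:
  assumes "norm u < r"
  shows "(Im u)\<^sup>2 < r\<^sup>2 - (Re u)\<^sup>2" "- r < Re u"
proof -
  show "(Im u)\<^sup>2 < r\<^sup>2 - (Re u)\<^sup>2"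
    using power_strict_mono[OF assms, of 2] by (simp add: cmod_power2)
  show "- r < Re u"
    using abs_Re_le_cmod[of u] assms by linarith
qed

lemma car_radius_C: "is_car_radius (starlike_phi (\<lambda>z. 1 + 4 * z / 3 + 2 * z\<^sup>2 / 3)) (1/2)"
proof (rule is_car_radiusI)
  fix u :: complex
  assume u: "norm u < 1/2"
  have "(Im u)\<^sup>2 < 1/4 - (Re u)\<^sup>2"
    using norm_less_imp_Re_Im(1)[OF u] by (simp add: power_divide)
  \<comment> \<open>With (Im u)^2 replaced by its bound, Re p - 1/2 becomes (1 + 2 Re u)^2/3;
    strictness comes from the bound on Im u.\<close>
  moreover have "0 \<le> 1 + 4 * Re u + 4 * (Re u)\<^sup>2"
    using zero_le_power2[of "1 + 2 * Re u"] by (simp add: power2_eq_square algebra_simps)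
  ultimately have "1/2 < 1 + 4 / 3 * Re u + 2 / 3 * ((Re u)\<^sup>2 - (Im u)\<^sup>2)"
    by argo
  also have "\<dots> = Re (1 + 4 * u / 3 + 2 * u\<^sup>2 / 3)"
    by (simp add: power2_eq_square)
  finally have "1/2 < Re (1 + 4 * u / 3 + 2 * u\<^sup>2 / 3)" .
  moreover have "norm (1 + 4 * u / 3 + 2 * u\<^sup>2 / 3 - 1) \<le> 1"
  proof -
    have "norm (4 * u / 3 + 2 * u\<^sup>2 / 3) \<le> 4 * norm u / 3 + 2 * (norm u)\<^sup>2 / 3"
      by (rule norm_triangle_le) (simp add: norm_mult norm_divide norm_power)
    also have "\<dots> \<le> 4 * (1/2) / 3 + 2 * (1/2)\<^sup>2 / 3"
      using u by (intro add_mono divide_right_mono mult_left_mono power_mono) auto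
    finally show ?thesis by (simp add: power2_eq_square)
  qed
  ultimately show "1 + 4 * u / 3 + 2 * u\<^sup>2 / 3 \<in> disc_segment"
    by (rule disc_segmentI)
qed (auto intro!: holomorphic_intros simp: power2_eq_square)

lemma car_radius_lim:
  "is_car_radius (starlike_phi (\<lambda>z. 1 + of_real (sqrt 2) * z + z\<^sup>2 / 2)) (sqrt 2 - 1)"
proof (rule is_car_radiusI)
  define s where "s = sqrt (2::real)"
  have ss: "s * s = 2" by (simp add: s_def)
  have s: "1414/1000 < s" "s < 1415/1000"
    unfolding s_def by (rule real_less_rsqrt, simp add: power2_eq_square)
      (rule real_less_lsqrt, simp_all add: power2_eq_square)
  show "0 < sqrt 2 - (1::real)" "sqrt 2 - 1 \<le> (1::real)"
    using s by (simp_all add: s_def)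
  have "1 + of_real s * - of_real (s - 1) + (- of_real (s - 1))\<^sup>2 / 2
      = complex_of_real (1 - s * (s - 1) + (s - 1)\<^sup>2 / 2)"
    by (simp add: power2_eq_square field_simps)
  also have "1 - s * (s - 1) + (s - 1)\<^sup>2 / 2 = 1/2"
    using ss by (simp add: power2_eq_square field_simps)
  finally show "1 + of_real (sqrt 2) * - of_real (sqrt 2 - 1) + (- of_real (sqrt 2 - 1))\<^sup>2 / 2
      = (1/2 :: complex)"
    by (simp add: s_def)
  fix u :: complex
  assume "norm u < sqrt 2 - 1"
  then have u: "norm u < s - 1" by (simp add: s_def)
  have sq: "(s - 1)\<^sup>2 = 3 - 2 * s"
    using ss by (simp add: power2_eq_square algebra_simps)
  \<comment> \<open>This product is Re p - 1/2 with (Im u)^2 replaced by its bound; its root 1 - s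
    is -r.\<close>
  have "0 < (Re u + s - 1) * (Re u + 1)"
    using norm_less_imp_Re_Im(2)[OF u] s by (intro mult_pos_pos) auto
  then have "1/2 < Re (1 + of_real s * u + u\<^sup>2 / 2)"
    using norm_less_imp_Re_Im(1)[OF u] unfolding sq by (simp add: power2_eq_square field_simps)
  moreover have "norm (1 + of_real s * u + u\<^sup>2 / 2 - 1) \<le> 1"
  proof -
    have "norm (of_real s * u + u\<^sup>2 / 2) \<le> s * norm u + (norm u)\<^sup>2 / 2"
      using s by (intro norm_triangle_le) (simp add: norm_mult norm_divide norm_power)
    also have "\<dots> \<le> s * (s - 1) + (s - 1)\<^sup>2 / 2"
      using u s by (intro add_mono divide_right_mono mult_left_mono power_mono) auto
    also have "\<dots> \<le> 1"
      using ss s unfolding sq by (simp add: field_simps)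
    finally show ?thesis by simp
  qed
  ultimately show "1 + of_real (sqrt 2) * u + u\<^sup>2 / 2 \<in> disc_segment"
    unfolding s_def by (rule disc_segmentI)
qed (auto intro!: holomorphic_intros)

text \<open>The function \<open>q = u + sqrt (1 + u\<^sup>2)\<close> satisfies \<open>q - 1/q = 2 u\<close> with \<open>Re q > 0\<close>, so
  \<open>|u| < 3/4\<close> becomes a condition on \<open>|q|\<^sup>2\<close> and \<open>Re q\<close>.\<close>
lemma crescent_disc_segment:
  fixes u :: complex
  assumes u: "norm u < 3/4"
  shows "u + csqrt (1 + u\<^sup>2) \<in> disc_segment"
proof -
  define v where "v = csqrt (1 + u\<^sup>2)"
  define q where "q = v + u"
  define p where "p = v - u"
  define m where "m = (norm q)\<^sup>2"
  have "norm (u\<^sup>2) < 1"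
    using u power_strict_mono[OF u, of 2] by (simp add: norm_power power_divide)
  then have "0 < Re (1 + u\<^sup>2)"
    using abs_Re_le_cmod[of "u\<^sup>2"] by simp
  also have "1 + u\<^sup>2 = v\<^sup>2"
    by (simp add: v_def)
  finally have "Re v \<noteq> 0"
    by (auto simp: power2_eq_square)
  then have v: "0 < Re v"
    using Re_csqrt[of "1 + u\<^sup>2"] unfolding v_def by linarith
  have qp: "q * p = 1"
  proof -
    have "q * p = v\<^sup>2 - u\<^sup>2" by (simp add: q_def p_def power2_eq_square algebra_simps)
    then show ?thesis by (simp add: v_def)
  qed
  then have q0: "q \<noteq> 0" by auto
  then have m0: "0 < m" by (simp add: m_def)
  have p: "p = cnj q / of_real m"
  proof -
    have "of_real m = q * cnj q"
      unfolding m_def by (rule complex_norm_square)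
    moreover have "p = 1 / q"
      using qp q0 by (simp add: field_simps)
    ultimately show ?thesis using q0 by simp
  qed
  have m: "m = (Re q)\<^sup>2 + (Im q)\<^sup>2"
    by (simp add: m_def cmod_power2)
  have "2 * Re v = Re q * (1 + 1 / m)"
  proof -
    have "2 * Re v = Re q + Re p" by (simp add: q_def p_def)
    then show ?thesis by (simp add: p algebra_simps)
  qed
  then have a0: "0 < Re q"
    using v m0 zero_less_mult_pos2[of "Re q" "1 + 1 / m"] by (simp add: add_pos_pos)
  have "4 * (norm u)\<^sup>2 = m + 1 / m + 2 - 4 * (Re q)\<^sup>2 / m"
  proof -
    have "q - p = 2 * u" by (simp add: q_def p_def)
    then have "4 * (norm u)\<^sup>2 = (norm (q - p))\<^sup>2"
      by (simp add: norm_mult power_mult_distrib)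
    also have "\<dots> = ((Re q)\<^sup>2 + (Im q)\<^sup>2) + ((Re q)\<^sup>2 + (Im q)\<^sup>2) / m / m
        + 2 * ((Im q)\<^sup>2 - (Re q)\<^sup>2) / m"
      unfolding cmod_power2 p using m0 by (simp add: power2_eq_square field_simps)
    also have "\<dots> = m + 1 / m + 2 * (m - 2 * (Re q)\<^sup>2) / m"
      unfolding m[symmetric] using m m0 by simp
    also have "\<dots> = m + 1 / m + 2 - 4 * (Re q)\<^sup>2 / m"
      using m0 by (simp add: field_simps)
    finally show ?thesis .
  qed
  moreover have "4 * (norm u)\<^sup>2 < 9/4"
    using power_strict_mono[OF u, of 2] by (simp add: power_divide)
  ultimately have "m * (m + 1 / m + 2 - 4 * (Re q)\<^sup>2 / m) < m * (9/4)"
    using m0 by simp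
  \<comment> \<open>This is |q^2 - 1|^2 < (9/4) |q|^2, written in m and Re q.\<close>
  then have key: "m * m + 1 - 4 * (Re q)\<^sup>2 < m / 4"
    using m0 by (simp add: algebra_simps)
  have "1/2 < Re q"
  proof (rule ccontr)
    assume "\<not> 1/2 < Re q"
    then have a: "4 * (Re q)\<^sup>2 \<le> 1"
      using a0 power_mono[of "Re q" "1/2" 2] by (simp add: power_divide)
    show False
    \<comment> \<open>If Re q \<le> 1/2, \<open>key\<close> makes m (m - 1/4) negative, so m < 1/4;
      then (Re q)^2 \<le> m turns \<open>key\<close> into (4 - m)(1/4 - m) < 0, which is
      impossible.\<close>
    proof (cases "1/4 \<le> m")
      case True
      then have "0 \<le> m * (m - 1/4)" by simp
      then show False using key a by (simp add: algebra_simps)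
    next
      case False
      then have "0 < (4 - m) * (1/4 - m)" by (intro mult_pos_pos) auto
      moreover have "(Re q)\<^sup>2 \<le> m" by (simp add: m)
      ultimately show False using key by (simp add: field_simps)
    qed
  qed
  moreover have "m < 5/2 * Re q"
  proof (rule ccontr)
    assume "\<not> m < 5/2 * Re q"
    then have "(Re q)\<^sup>2 \<le> (2/5 * m)\<^sup>2"
      using a0 by (intro power_mono) auto
    moreover have "0 \<le> (3/5 * m - 1)\<^sup>2" by simp
    ultimately show False
      using key m0 by (simp add: power2_eq_square algebra_simps)
  qed
  ultimately show ?thesis
    by (simp add: disc_segment_def m_def q_def v_def add.commute)
qed

lemma car_radius_crescent: "is_car_radius (starlike_phi (\<lambda>z. z + csqrt (1 + z\<^sup>2))) (3/4)"
proof (rule is_car_radiusI)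
  have "1 + z\<^sup>2 \<notin> \<real>\<^sub>\<le>\<^sub>0" if "norm z < 1" for z :: complex
    using that by (intro one_plus_notin_nonpos_Reals) (simp add: norm_power power_less_one_iff)
  then show "(\<lambda>z. z + csqrt (1 + z\<^sup>2)) holomorphic_on ball 0 1"
    by (intro holomorphic_intros) auto
  have "csqrt (25/16) = 5/4"
    by (rule csqrt_unique) (auto simp: power2_eq_square)
  moreover have "1 + (- of_real (3/4))\<^sup>2 = (25/16 :: complex)"
    by (simp add: power2_eq_square)
  ultimately show "- of_real (3/4) + csqrt (1 + (- of_real (3/4))\<^sup>2) = 1/2"
    by (simp only:) simp
qed (simp_all add: crescent_disc_segment)

section \<open>Sine and nephroid\<close>

lemma sin_disc_segment:
  fixes u :: complex
  assumes u: "norm u < pi / 6"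
  shows "1 + sin u \<in> disc_segment"
proof (rule disc_segmentI)
  define x y where "x = Re u" and "y = Im u"
  define R where "R = pi / 6"
  have R: "0 < R" "R < 53/100"
    using pi_approx by (simp_all add: R_def)
  have y2: "y\<^sup>2 < R\<^sup>2 - x\<^sup>2" and xR: "\<bar>x\<bar> < R"
    using norm_less_imp_Re_Im(1)[OF u] abs_Re_le_cmod[of u] u by (simp_all add: x_def y_def R_def)
  have R2: "R\<^sup>2 < 281/1000"
    using power_strict_mono[OF R(2), of 2] R by (simp add: power2_eq_square)
  have y1: "y\<^sup>2 < 281/1000"
    using y2 R2 zero_le_power2[of x] by linarith
  have "\<bar>y\<bar> \<le> 1"
    using y1 abs_le_square_iff[of y 1] by simp
  then have ch: "cosh y \<le> 1 + y\<^sup>2" by (rule cosh_upper_quadratic)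
  have Re: "Re (sin u) = sin x * cosh y" and Im: "Im (sin u) = cos x * sinh y"
    by (simp_all add: Re_sin Im_sin cosh_field_def sinh_field_def x_def y_def)
  show "1/2 < Re (1 + sin u)"
  proof (cases "0 \<le> x")
    case True
    have "0 \<le> sin x"
      using True xR R by (intro sin_ge_zero) (auto simp: R_def)
    then show ?thesis
      by (simp add: Re add_pos_nonneg)
  next
    case False
    define t where "t = - x"
    have t: "0 < t" "t < R" using False xR by (auto simp: t_def)
    have sinR: "sin R = 1/2" by (simp add: R_def sin_30)
    have cosR: "3/4 \<le> cos R"
      using cos_lower_quadratic[of R] R2 by simp
    obtain z where z: "t < z" "z < R" "sin R - sin t = (R - t) * cos z"
      \<comment> \<open>A slope of at least 3/4 puts sin t below 1/2 by at least 3/4 (R - t), while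
        the factor cosh y adds at most y^2/2 \<le> 53/100 (R - t).\<close>
      using MVT2[OF t(2), of sin cos] by (auto intro: DERIV_sin)
    have "cos R \<le> cos z"
      using z t R by (intro cos_monotone_0_pi_le) (auto simp: R_def)
    then have "(R - t) * (3/4) \<le> sin R - sin t"
      using cosR t unfolding z(3) by (intro mult_left_mono) auto
    moreover have "y\<^sup>2 \<le> (R - t) * (106/100)"
    proof -
      have "y\<^sup>2 \<le> (R - t) * (R + t)" using y2 by (simp add: t_def power2_eq_square algebra_simps)
      also have "\<dots> \<le> (R - t) * (106/100)" using t R by (intro mult_left_mono) auto
      finally show ?thesis .
    qed
    moreover have "sin t * cosh y \<le> sin t + sin t * y\<^sup>2"
      using mult_left_mono[OF ch, of "sin t"] sin_ge_zero[of t] t by (simp add: R_def algebra_simps)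
    moreover have "sin t * y\<^sup>2 \<le> 1/2 * y\<^sup>2"
    proof (rule mult_right_mono)
      show "sin t \<le> 1/2"
        unfolding sinR[symmetric] using t R by (intro sin_monotone_2pi_le) (auto simp: R_def)
    qed simp
    ultimately have "sin t * cosh y < 1/2"
      using sinR t by argo
    then show ?thesis by (simp add: Re t_def)
  qed
  have "(norm (sin u))\<^sup>2 = (sin x)\<^sup>2 + (cosh y)\<^sup>2 - 1"
  proof -
    have "(norm (sin u))\<^sup>2 = (sin x)\<^sup>2 * (cosh y)\<^sup>2 + (1 - (sin x)\<^sup>2) * ((cosh y)\<^sup>2 - 1)"
      unfolding cmod_power2 Re Im power_mult_distrib cos_squared_eq sinh_square_eq ..
    then show ?thesis by (simp add: algebra_simps)
  qed
  also have "\<dots> \<le> x\<^sup>2 + (1 + y\<^sup>2)\<^sup>2 - 1"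
  proof -
    have "(sin x)\<^sup>2 \<le> x\<^sup>2"
      using abs_sin_x_le_abs_x[of x] unfolding abs_le_square_iff .
    moreover have "(cosh y)\<^sup>2 \<le> (1 + y\<^sup>2)\<^sup>2"
      using ch by (intro power_mono) auto
    ultimately show ?thesis by linarith
  qed
  also have "\<dots> = x\<^sup>2 + 2 * y\<^sup>2 + y\<^sup>2 * y\<^sup>2"
    by (simp add: power2_eq_square algebra_simps)
  also have "\<dots> \<le> 1"
  proof -
    have "y\<^sup>2 * y\<^sup>2 \<le> 1 * y\<^sup>2" using y1 by (intro mult_right_mono) auto
    then show ?thesis using y1 y2 R2 zero_le_power2[of x] by linarith
  qed
  finally show "norm (1 + sin u - 1) \<le> 1"
    by (simp add: power_le_one_iff)
qed

lemma car_radius_sin: "is_car_radius (starlike_phi (\<lambda>z. 1 + sin z)) (arcsin (1/2))"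
proof (rule is_car_radiusI)
  have a: "arcsin (1/2) = pi / 6"
    using arcsin_sin[of "pi / 6"] by (simp add: sin_30)
  show "0 < arcsin (1/2 :: real)" "arcsin (1/2 :: real) \<le> 1"
    unfolding a using pi_approx by simp_all
  have "sin (complex_of_real (pi / 6)) = of_real (1/2)"
    by (simp only: sin_of_real sin_30)
  then show "1 + sin (- of_real (arcsin (1/2))) = (1/2 :: complex)"
    unfolding a sin_minus by simp
  show "1 + sin u \<in> disc_segment" if "norm u < arcsin (1/2)" for u :: complex
    using that unfolding a by (rule sin_disc_segment)
qed (auto intro!: holomorphic_intros)

text \<open>576/1000 is just below 1/sqrt 3. For Re u = -t < 0, replacing (Im u)^2 by its bound and
  1/2 by 1 - r + r^3/3 leaves (r - t)(1 + r^2 - 4/3 (r^2 + r t + t^2)), whose second factor is at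
  least 1 - 3 r^2.\<close>

lemma nephroid_disc_segment:
  fixes u :: complex
  assumes u: "norm u < r" and r: "r < 576/1000" "2 * r ^ 3 - 6 * r + 3 = 0"
  shows "1 + u - u ^ 3 / 3 \<in> disc_segment"
proof (rule disc_segmentI)
  define x y where "x = Re u" and "y = Im u"
  have y2: "y\<^sup>2 < r\<^sup>2 - x\<^sup>2" and xr: "\<bar>x\<bar> < r"
    using norm_less_imp_Re_Im(1)[OF u] abs_Re_le_cmod[of u] u by (simp_all add: x_def y_def)
  have "0 \<le> r" using xr by simp
  then have r2: "r\<^sup>2 < 1/3"
    using power_strict_mono[OF r(1), of 2] by (simp add: power2_eq_square)
  have Re: "Re (1 + u - u ^ 3 / 3) = 1 + x - x ^ 3 / 3 + x * y\<^sup>2"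
    by (simp add: x_def y_def power3_eq_cube power2_eq_square field_simps)
  show "1/2 < Re (1 + u - u ^ 3 / 3)"
  proof (cases "0 \<le> x")
    case True
    have "x * (x * x) \<le> x * 1"
      using True xr r mult_mono[of x 1 x 1] by (intro mult_left_mono) auto
    then have "x ^ 3 \<le> x" by (simp add: power3_eq_cube)
    moreover have "0 \<le> x * y\<^sup>2" using True by simp
    ultimately show ?thesis
      unfolding Re using True by argo
  next
    case False
    define t where "t = - x"
    have t: "0 < t" "t < r" using False xr by (auto simp: t_def)
    have "t * y\<^sup>2 < t * (r\<^sup>2 - t\<^sup>2)"
      using t y2 by (simp add: t_def)
    moreover have "0 \<le> (r - t) * (2 * (1 + r\<^sup>2) - 8/3 * (r\<^sup>2 + r * t + t\<^sup>2))"
    proof (rule mult_nonneg_nonneg)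
      have "r * t \<le> r\<^sup>2" "t\<^sup>2 \<le> r\<^sup>2"
        using t by (auto simp: power2_eq_square intro: mult_mono)
      then show "0 \<le> 2 * (1 + r\<^sup>2) - 8/3 * (r\<^sup>2 + r * t + t\<^sup>2)"
        using r2 by argo
    qed (use t in simp)
    ultimately have "1/2 < 1 - t + t ^ 3 / 3 - t * y\<^sup>2"
      using r(2) by (simp add: power3_eq_cube power2_eq_square field_simps)
    then show ?thesis
      unfolding Re by (simp add: t_def)
  qed
  have "norm (u - u ^ 3 / 3) \<le> norm u + norm u ^ 3 / 3"
    by (rule norm_triangle_le_diff) (simp add: norm_divide norm_power)
  also have "\<dots> \<le> 576/1000 + (576/1000) ^ 3 / 3"
    using u r by (intro add_mono divide_right_mono power_mono) auto
  also have "\<dots> \<le> 1" by (simp add: power3_eq_cube)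
  finally show "norm (1 + u - u ^ 3 / 3 - 1) \<le> 1"
    by simp
qed

lemma car_radius_nephroid:
  "\<exists>r::real. 0 < r \<and> r < 1 \<and> 2 * r ^ 3 - 6 * r + 3 = 0 \<and>
     (\<forall>s. 0 < s \<and> s < r \<longrightarrow> 2 * s ^ 3 - 6 * s + 3 \<noteq> 0) \<and>
     is_car_radius (starlike_phi (\<lambda>z. 1 + z - z ^ 3 / 3)) r"
proof -
  define g where "g = (\<lambda>r::real. 2 * r ^ 3 - 6 * r + 3)"
  have "\<exists>r\<ge>0. r \<le> 57/100 \<and> g r = 0"
    unfolding g_def by (rule IVT2') (auto intro!: continuous_intros simp: power3_eq_cube)
  then obtain r where r: "0 \<le> r" "r \<le> 57/100" "g r = 0" by blast
  have "r \<noteq> 0" using r(3) by (auto simp: g_def)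
  with r have r0: "0 < r" by simp
  have "g s \<noteq> 0" if s: "0 < s" "s < r" for s
  proof -
    have "s * s < 1 * 1" "s * r < 1 * 1" "r * r < 1 * 1"
      using s r by (intro mult_strict_mono; simp)+
    \<comment> \<open>Factoring g s - g r shows g s > g r = 0 to the left of r, so the root found is
      the smallest positive one.\<close>
    then have "0 < (r - s) * (6 - 2 * (s * s + s * r + r * r))"
      using s by (intro mult_pos_pos) auto
    also have "\<dots> = g s - g r"
      by (simp add: g_def power3_eq_cube algebra_simps)
    finally show ?thesis using r(3) by simp
  qed
  moreover have "is_car_radius (starlike_phi (\<lambda>z. 1 + z - z ^ 3 / 3)) r"
  proof (rule is_car_radiusI)
    have "1 - r + r ^ 3 / 3 = 1/2" using r(3) by (simp add: g_def)
    then have "complex_of_real (1 - r + r ^ 3 / 3) = of_real (1/2)" by (simp only:)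
    then show "1 + - of_real r - (- of_real r) ^ 3 / 3 = (1/2 :: complex)" by simp
    show "1 + u - u ^ 3 / 3 \<in> disc_segment" if "norm u < r" for u :: complex
      using nephroid_disc_segment[OF that] r by (simp add: g_def)
  qed (use r r0 in \<open>auto intro!: holomorphic_intros\<close>)
  ultimately show ?thesis
    using r r0 by (intro exI[of _ r]) (auto simp: g_def)
qed

theorem theorem4p3:
  shows
   "(\<forall>c::real. 3/4 < c \<and> c \<le> 1 \<longrightarrow>
       is_car_radius (starlike_phi (\<lambda>z. csqrt (1 + of_real c * z))) (3 / (4 * c)))
  \<and> (\<forall>\<alpha>::real. 0 \<le> \<alpha> \<and> \<alpha> < 1/2 \<longrightarrow>
       is_car_radius (starlike_phi (\<lambda>z. of_real \<alpha> + of_real (1 - \<alpha>) * csqrt (1 + z)))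
         ((3 - 4 * \<alpha>) / (4 * (1 - \<alpha>)^2)))
  \<and> (\<forall>\<alpha>::real. 0 \<le> \<alpha> \<and> \<alpha> < (exp 1 - 2) / (2 * (exp 1 - 1)) \<longrightarrow>
       is_car_radius (starlike_phi (\<lambda>z. of_real \<alpha> + of_real (1 - \<alpha>) * exp z))
         (ln (2 * (1 - \<alpha>) / (1 - 2 * \<alpha>))))
  \<and> is_car_radius
      (starlike_phi (\<lambda>z. of_real (sqrt 2) - of_real (sqrt 2 - 1) *
         csqrt ((1 - z) / (1 + 2 * of_real (sqrt 2 - 1) * z))))
      ((39 + 17 * sqrt 2) / 82)
  \<and> is_car_radius (starlike_phi (\<lambda>z. 1 + 4 * z / 3 + 2 * z^2 / 3)) (1/2)
  \<and> is_car_radius (starlike_phi (\<lambda>z. 1 + of_real (sqrt 2) * z + z^2 / 2)) (sqrt 2 - 1)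
  \<and> is_car_radius (starlike_phi (\<lambda>z. z + csqrt (1 + z^2))) (3/4)
  \<and> is_car_radius (starlike_phi (\<lambda>z. 1 + sin z)) (arcsin (1/2))
  \<and> (\<exists>r9::real. 0 < r9 \<and> r9 < 1 \<and> 2 * r9^3 - 6 * r9 + 3 = 0 \<and>
        (\<forall>s. 0 < s \<and> s < r9 \<longrightarrow> 2 * s^3 - 6 * s + 3 \<noteq> 0) \<and>
        is_car_radius (starlike_phi (\<lambda>z. 1 + z - z^3 / 3)) r9)"
  by (intro conjI allI impI car_radius_sqrt car_radius_lemniscate_order car_radius_exp_order
        car_radius_RL car_radius_C car_radius_lim car_radius_crescent car_radius_sin
        car_radius_nephroid) auto

end
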